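(* Let $\varphi\in L^2(\mathbb{R}^2,\mathbb{H})$ be a quaternion window function (i.e. $\varphi$ is not the zero function) and let $f\in L^2(\mathbb{R}^2,\mathbb{H})$. Then $$\|\mathcal{G}_\varphi f\|_2^2=\|f\|_2^2\,\|\varphi\|_2^2 ,$$ where $\|\mathcal{G}_\varphi f\|_2^2=\int_{\mathbb{R}^2}\int_{\mathbb{R}^2}|\mathcal{G}_\varphi f(\omega,b)|^2\,d\omega\,db$.
   Context: $\mathbb{H}$ is the real quaternion algebra with units $i,j,k$ ($i^2=j^2=k^2=ijk=-1$), conjugation $\overline{q}$ and modulus $|q|=\sqrt{q\overline{q}}$. $L^2(\mathbb{R}^2,\mathbb{H})$ is the space of measurable $f:\mathbb{R}^2\to\mathbb{H}$ with $\|f\|_2^2=\int_{\mathbb{R}^2}|f(x)|^2dx<\infty$. The Gabor quaternionic Fourier transform (GQFT) of $f\in L^2(\mathbb{R}^2,\mathbb{H})$ with respect to a non-zero window $\varphi\in L^2(\mathbb{R}^2,\mathbb{H})$ is $$\mathcal{G}_\varphi f(\omega,b)=\int_{\mathbb{R}^2}e^{-2\pi i x_1\omega_1}f(x)\overline{\varphi(x-b)}e^{-2\pi j x_2\omega_2}dx,\qquad \omega,b\in\mathbb{R}^2 .$$ *)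

theory Defs
  imports "HOL-Analysis.Analysis"
begin

subsection \<open>The real quaternion algebra\<close>

datatype quat = Quat (qre: real) (qim1: real) (qim2: real) (qim3: real)

lemma quat_eq_iff:
  "p = q \<longleftrightarrow> qre p = qre q \<and> qim1 p = qim1 q \<and> qim2 p = qim2 q \<and> qim3 p = qim3 q"
  by (auto intro: quat.expand)

instantiation quat :: ab_group_add
begin
definition "0 = Quat 0 0 0 0"
definition "- p = Quat (- qre p) (- qim1 p) (- qim2 p) (- qim3 p)"
definition "p + q = Quat (qre p + qre q) (qim1 p + qim1 q) (qim2 p + qim2 q) (qim3 p + qim3 q)"
definition "p - q = Quat (qre p - qre q) (qim1 p - qim1 q) (qim2 p - qim2 q) (qim3 p - qim3 q)"
instance
  by standard (simp_all add: quat_eq_iff zero_quat_def uminus_quat_def plus_quat_def minus_quat_def)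
end

lemma quat_zero_sel [simp]:
  "qre 0 = 0" "qim1 0 = 0" "qim2 0 = 0" "qim3 0 = 0"
  by (simp_all add: zero_quat_def)

lemma quat_uminus_sel [simp]:
  "qre (- p) = - qre p" "qim1 (- p) = - qim1 p" "qim2 (- p) = - qim2 p" "qim3 (- p) = - qim3 p"
  by (simp_all add: uminus_quat_def)

lemma quat_plus_sel [simp]:
  "qre (p + q) = qre p + qre q" "qim1 (p + q) = qim1 p + qim1 q"
  "qim2 (p + q) = qim2 p + qim2 q" "qim3 (p + q) = qim3 p + qim3 q"
  by (simp_all add: plus_quat_def)

lemma quat_minus_sel [simp]:
  "qre (p - q) = qre p - qre q" "qim1 (p - q) = qim1 p - qim1 q"
  "qim2 (p - q) = qim2 p - qim2 q" "qim3 (p - q) = qim3 p - qim3 q"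
  by (simp_all add: minus_quat_def)

instantiation quat :: real_vector
begin
definition "r *\<^sub>R q = Quat (r * qre q) (r * qim1 q) (r * qim2 q) (r * qim3 q)"
instance
  by standard (simp_all add: quat_eq_iff scaleR_quat_def algebra_simps)
end

lemma quat_scaleR_sel [simp]:
  "qre (r *\<^sub>R q) = r * qre q" "qim1 (r *\<^sub>R q) = r * qim1 q"
  "qim2 (r *\<^sub>R q) = r * qim2 q" "qim3 (r *\<^sub>R q) = r * qim3 q"
  by (simp_all add: scaleR_quat_def)

instantiation quat :: ring_1
begin
definition "1 = Quat 1 0 0 0"
definition "p * q = Quat
  (qre p * qre q - qim1 p * qim1 q - qim2 p * qim2 q - qim3 p * qim3 q)
  (qre p * qim1 q + qim1 p * qre q + qim2 p * qim3 q - qim3 p * qim2 q)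
  (qre p * qim2 q - qim1 p * qim3 q + qim2 p * qre q + qim3 p * qim1 q)
  (qre p * qim3 q + qim1 p * qim2 q - qim2 p * qim1 q + qim3 p * qre q)"
instance
  by standard (simp_all add: quat_eq_iff one_quat_def times_quat_def algebra_simps)
end

lemma quat_one_sel [simp]:
  "qre 1 = 1" "qim1 1 = 0" "qim2 1 = 0" "qim3 1 = 0"
  by (simp_all add: one_quat_def)

lemma quat_times_sel [simp]:
  "qre (p * q) = qre p * qre q - qim1 p * qim1 q - qim2 p * qim2 q - qim3 p * qim3 q"
  "qim1 (p * q) = qre p * qim1 q + qim1 p * qre q + qim2 p * qim3 q - qim3 p * qim2 q"
  "qim2 (p * q) = qre p * qim2 q - qim1 p * qim3 q + qim2 p * qre q + qim3 p * qim1 q"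
  "qim3 (p * q) = qre p * qim3 q + qim1 p * qim2 q - qim2 p * qim1 q + qim3 p * qre q"
  by (simp_all add: times_quat_def)

instance quat :: real_algebra_1
  by standard (simp_all add: quat_eq_iff algebra_simps)

definition quat_i :: quat where "quat_i = Quat 0 1 0 0"
definition quat_j :: quat where "quat_j = Quat 0 0 1 0"
definition quat_k :: quat where "quat_k = Quat 0 0 0 1"

lemma quat_units:
  "quat_i * quat_i = -1" "quat_j * quat_j = -1" "quat_k * quat_k = -1"
  "quat_i * quat_j * quat_k = -1"
  by (simp_all add: quat_eq_iff quat_i_def quat_j_def quat_k_def)

lemma quat_expand:
  "q = qre q *\<^sub>R 1 + qim1 q *\<^sub>R quat_i + qim2 q *\<^sub>R quat_j + qim3 q *\<^sub>R quat_k"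
  by (simp add: quat_eq_iff quat_i_def quat_j_def quat_k_def)

definition quat_cnj :: "quat \<Rightarrow> quat"
  where "quat_cnj q = Quat (qre q) (- qim1 q) (- qim2 q) (- qim3 q)"

lemma quat_cnj_sel [simp]:
  "qre (quat_cnj q) = qre q" "qim1 (quat_cnj q) = - qim1 q"
  "qim2 (quat_cnj q) = - qim2 q" "qim3 (quat_cnj q) = - qim3 q"
  by (simp_all add: quat_cnj_def)

subsection \<open>Modulus, topology and exponential\<close>

instantiation quat :: real_inner
begin
definition "inner p q = qre p * qre q + qim1 p * qim1 q + qim2 p * qim2 q + qim3 p * qim3 q"
definition "norm (q :: quat) = sqrt (inner q q)"
definition "sgn (q :: quat) = q /\<^sub>R norm q"
definition "dist (p :: quat) q = norm (p - q)"
definition [code del]: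
  "(uniformity :: (quat \<times> quat) filter) = (INF e\<in>{0 <..}. principal {(x, y). dist x y < e})"
definition [code del]:
  "open (U :: quat set) \<longleftrightarrow> (\<forall>x\<in>U. eventually (\<lambda>(x', y). x' = x \<longrightarrow> y \<in> U) uniformity)"
instance
proof
  fix p q r :: quat and c :: real
  show "inner p q = inner q p"
    by (simp add: inner_quat_def algebra_simps)
  show "inner (p + q) r = inner p r + inner q r" "inner (c *\<^sub>R p) q = c * inner p q"
    by (simp_all add: inner_quat_def algebra_simps)
  show "0 \<le> inner p p"
    by (simp add: inner_quat_def)
  show "inner p p = 0 \<longleftrightarrow> p = 0"
    by (auto simp: inner_quat_def quat_eq_iff add_nonneg_eq_0_iff)
qed (fact norm_quat_def sgn_quat_def dist_quat_def uniformity_quat_def open_quat_def)+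
end

instantiation quat :: euclidean_space
begin
definition "(Basis :: quat set) = {1, quat_i, quat_j, quat_k}"
instance
proof
  have distinct: "quat_i \<noteq> 1" "quat_j \<noteq> 1" "quat_k \<noteq> 1"
    "quat_i \<noteq> quat_j" "quat_i \<noteq> quat_k" "quat_j \<noteq> quat_k"
    by (simp_all add: quat_i_def quat_j_def quat_k_def one_quat_def)
  show "(Basis :: quat set) \<noteq> {}" "finite (Basis :: quat set)"
    by (simp_all add: Basis_quat_def)
  show "inner u v = (if u = v then 1 else 0)" if "u \<in> Basis" "v \<in> Basis" for u v :: quat
    using that distinct distinct [symmetric] unfolding Basis_quat_def
    by (elim insertE emptyE; hypsubst)
      (simp_all add: inner_quat_def, simp_all add: quat_i_def quat_j_def quat_k_def)
  show "(\<forall>u\<in>Basis. inner x u = 0) \<longleftrightarrow> x = 0" for x :: quat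
    by (simp add: Basis_quat_def inner_quat_def)
      (simp add: quat_i_def quat_j_def quat_k_def quat_eq_iff [of x])
qed
end

lemma quat_norm_eq:
  "norm q = sqrt ((qre q)\<^sup>2 + (qim1 q)\<^sup>2 + (qim2 q)\<^sup>2 + (qim3 q)\<^sup>2)"
  by (simp add: norm_quat_def inner_quat_def power2_eq_square)

lemma quat_norm_square:
  "(norm q)\<^sup>2 = (qre q)\<^sup>2 + (qim1 q)\<^sup>2 + (qim2 q)\<^sup>2 + (qim3 q)\<^sup>2"
  by (simp add: quat_norm_eq)

lemma quat_norm_cnj:
  "of_real ((norm q)\<^sup>2) = q * quat_cnj q"  "norm q = sqrt (qre (q * quat_cnj q))"
  by (simp_all add: quat_eq_iff of_real_def quat_norm_eq power2_eq_square)

lemma quat_norm_mult: "norm (p * q) = norm p * norm (q :: quat)"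
  unfolding quat_norm_eq real_sqrt_mult [symmetric]
  by (rule arg_cong [where f = sqrt]) (simp add: power2_eq_square algebra_simps)

instantiation quat :: real_normed_div_algebra
begin
definition "inverse q = quat_cnj q /\<^sub>R (norm q)\<^sup>2"
definition "p div q = p * inverse (q :: quat)"
instance
proof
  fix p q :: quat
  show "norm (p * q) = norm p * norm q"
    by (rule quat_norm_mult)
  show "inverse (0 :: quat) = 0"
    by (simp add: inverse_quat_def)
  show "p div q = p * inverse q"
    by (rule divide_quat_def)
  assume "q \<noteq> 0"
  then have nz: "norm q \<noteq> 0" by simp
  have "q * quat_cnj q = (norm q)\<^sup>2 *\<^sub>R 1" "quat_cnj q * q = (norm q)\<^sup>2 *\<^sub>R 1"
    by (simp_all add: quat_eq_iff quat_norm_square)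
      (simp_all add: power2_eq_square)
  with nz show "q * inverse q = 1" "inverse q * q = 1"
    by (simp_all add: inverse_quat_def)
qed
end

subsection \<open>Square-integrable functions on the plane and the Gabor quaternionic Fourier transform\<close>

text \<open>The squared norm takes values in the extended nonnegative reals, so that it is
  defined (possibly infinite) for every function.\<close>

definition quat_L2_norm_sq :: "(real \<times> real \<Rightarrow> quat) \<Rightarrow> ennreal"
  where "quat_L2_norm_sq f = (\<integral>\<^sup>+ x. ennreal ((norm (f x))\<^sup>2) \<partial>lebesgue)"

definition quat_L2 :: "(real \<times> real \<Rightarrow> quat) set"
  where "quat_L2 = {f. f \<in> borel_measurable lebesgue \<and> quat_L2_norm_sq f < \<infinity>}"

definition gqft :: "(real \<times> real \<Rightarrow> quat) \<Rightarrow> (real \<times> real \<Rightarrow> quat) \<Rightarrow>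
    real \<times> real \<Rightarrow> real \<times> real \<Rightarrow> quat"
  where "gqft \<phi> f \<omega> b =
    (\<integral> x. exp ((- (2 * pi * fst x * fst \<omega>)) *\<^sub>R quat_i) * f x * quat_cnj (\<phi> (x - b))
          * exp ((- (2 * pi * snd x * snd \<omega>)) *\<^sub>R quat_j) \<partial>lebesgue)"

definition gqft_norm_sq :: "(real \<times> real \<Rightarrow> quat) \<Rightarrow> (real \<times> real \<Rightarrow> quat) \<Rightarrow> ennreal"
  where "gqft_norm_sq \<phi> f =
    (\<integral>\<^sup>+ b. (\<integral>\<^sup>+ \<omega>. ennreal ((norm (gqft \<phi> f \<omega> b))\<^sup>2) \<partial>lebesgue) \<partial>lebesgue)"

end

theory Submission
  imports Defs "HOL-Probability.Characteristic_Functions" "HOL-Real_Asymp.Real_Asymp"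
begin

text \<open>
  For fixed \<open>b\<close>, the transform is the two-sided quaternionic Fourier transform of
  \<open>h\<^sub>b(x) = f(x) cnj (\<phi>(x - b))\<close>, which is integrable for every \<open>b\<close> and square-integrable for
  almost every \<open>b\<close>. Plancherel for \<open>h \<in> L\<^sup>1 \<inter> L\<^sup>2\<close> turns the inner integral into
  \<open>\<integral>|f(x)|\<^sup>2 |\<phi>(x - b)|\<^sup>2 dx\<close>, and Tonelli in \<open>b\<close> finishes the argument.

  Plancherel itself: the Gaussian weight is even in each coordinate, so the exponentials on both
  sides integrate against it to a real scalar, which commutes with quaternions. Hence
  \<open>\<integral>exp(-|\<omega>|\<^sup>2/2c\<^sup>2) |Fh(\<omega>)|\<^sup>2 d\<omega>\<close> is a Gaussian average of the autocorrelation
  \<open>\<integral>\<langle>h(x), h(x + t)\<rangle> dx\<close> over \<open>t\<close> of size \<open>1/c\<close>. As \<open>c \<rightarrow> \<infinity>\<close>, continuity of translation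
  in \<open>L\<^sup>2\<close> gives \<open>\<integral>|h|\<^sup>2\<close> on that side, monotone convergence gives \<open>\<integral>|Fh|\<^sup>2\<close> on the other.
\<close>

subsection \<open>Translation of functions on Euclidean space\<close>

lemma nn_integral_lborel_translate:
  fixes g :: "'a::euclidean_space \<Rightarrow> ennreal"
  assumes [measurable]: "g \<in> borel_measurable borel"
  shows "(\<integral>\<^sup>+ x. g (x + t) \<partial>lborel) = (\<integral>\<^sup>+ x. g x \<partial>lborel)"
proof -
  have "(\<integral>\<^sup>+ x. g x \<partial>lborel) = (\<integral>\<^sup>+ x. g x \<partial>distr lborel borel ((+) t))"
    by (simp only: lborel_distr_plus)
  also have "\<dots> = (\<integral>\<^sup>+ x. g (t + x) \<partial>lborel)"
    by (subst nn_integral_distr) simp_all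
  finally show ?thesis by (simp add: add.commute)
qed

lemma lborel_translate_iff:
  fixes f :: "'a::euclidean_space \<Rightarrow> 'b::{banach, second_countable_topology}"
  assumes [measurable]: "f \<in> borel_measurable borel"
  shows integrable_lborel_translate: "integrable lborel (\<lambda>x. f (x + t)) \<longleftrightarrow> integrable lborel f"
    and integral_lborel_translate: "(\<integral> x. f (x + t) \<partial>lborel) = (\<integral> x. f x \<partial>lborel)"
proof -
  have "integrable (distr lborel borel ((+) t)) f \<longleftrightarrow> integrable lborel (\<lambda>x. f (t + x))"
    by (subst integrable_distr_eq) simp_all
  then show "integrable lborel (\<lambda>x. f (x + t)) \<longleftrightarrow> integrable lborel f"
    by (simp only: lborel_distr_plus add.commute)
  have "(\<integral> x. f x \<partial>distr lborel borel ((+) t)) = (\<integral> x. f (t + x) \<partial>lborel)"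
    by (subst integral_distr) simp_all
  then show "(\<integral> x. f (x + t) \<partial>lborel) = (\<integral> x. f x \<partial>lborel)"
    by (simp only: lborel_distr_plus add.commute)
qed

text \<open>An open superset \<open>U\<close> of \<open>A\<close> of nearly the same measure eventually contains \<open>x + t n\<close>
  for each \<open>x \<in> A\<close>.\<close>

lemma emeasure_translation_diff_small:
  fixes A :: "'a::euclidean_space set"
  assumes A [measurable]: "A \<in> sets borel" and fin: "emeasure lborel A < \<infinity>"
    and t: "t \<longlonglongrightarrow> 0" and e: "(e::real) > 0"
  shows "\<forall>\<^sub>F n in sequentially. emeasure lborel {x \<in> A. x + t n \<notin> A} \<le> ennreal e"
proof -
  obtain U where U: "open U" "A \<subseteq> U" "emeasure lborel (U - A) < ennreal (e/2)"
    using outer_regular_lborel[OF A, of "e/2"] e by auto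
  have [measurable]: "U \<in> sets borel" using U by auto
  have "(\<lambda>n. \<integral>\<^sup>+ x. indicator {x \<in> A. x + t n \<notin> U} x \<partial>lborel) \<longlonglongrightarrow> (\<integral>\<^sup>+ (x::'a). 0 \<partial>lborel)"
  proof (rule nn_integral_dominated_convergence[where w = "indicator A"])
    show "(\<integral>\<^sup>+ x. indicator A x \<partial>lborel) < \<infinity>" using fin by simp
    show "AE x in lborel. (\<lambda>n. indicator {x \<in> A. x + t n \<notin> U} x) \<longlonglongrightarrow> (0::ennreal)"
    proof (rule AE_I2)
      fix x
      show "(\<lambda>n. indicator {x \<in> A. x + t n \<notin> U} x) \<longlonglongrightarrow> (0::ennreal)"
      proof (cases "x \<in> A")
        case True
        have "(\<lambda>n. x + t n) \<longlonglongrightarrow> x + 0" by (intro tendsto_intros t)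
        then have "\<forall>\<^sub>F n in sequentially. x + t n \<in> U"
          using U True topological_tendstoD[of "\<lambda>n. x + t n" x] by auto
        then show ?thesis
          by (intro tendsto_eventually) (auto elim!: eventually_mono simp: indicator_def)
      qed simp
    qed
  qed (auto simp: indicator_def)
  then have "\<forall>\<^sub>F n in sequentially. (\<integral>\<^sup>+ x. indicator {x \<in> A. x + t n \<notin> U} x \<partial>lborel) < ennreal (e/2)"
    using e by (intro order_tendstoD) auto
  then show ?thesis
  proof (rule eventually_mono)
    fix n assume *: "(\<integral>\<^sup>+ x. indicator {x \<in> A. x + t n \<notin> U} x \<partial>lborel) < ennreal (e/2)"
    have "emeasure lborel {x \<in> A. x + t n \<notin> A} = (\<integral>\<^sup>+ x. indicator {x \<in> A. x + t n \<notin> A} x \<partial>lborel)"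
      by simp
    also have "\<dots> \<le> (\<integral>\<^sup>+ x. indicator {x \<in> A. x + t n \<notin> U} x + indicator (U - A) (x + t n) \<partial>lborel)"
      by (intro nn_integral_mono) (auto simp: indicator_def)
    also have "\<dots> = (\<integral>\<^sup>+ x. indicator {x \<in> A. x + t n \<notin> U} x \<partial>lborel) + emeasure lborel (U - A)"
      by (subst nn_integral_add) (simp_all add: nn_integral_lborel_translate[of "indicator (U - A)"])
    also have "\<dots> \<le> ennreal (e/2) + ennreal (e/2)"
      using * U by (intro add_mono) auto
    also have "\<dots> = ennreal e" using e by (simp flip: ennreal_plus)
    finally show "emeasure lborel {x \<in> A. x + t n \<notin> A} \<le> ennreal e" .
  qed
qed

section \<open>Continuity of translation in L^1 and L^2\<close>

text \<open>Induction over integrable functions: indicators of sets of finite measure are handled by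
  \<open>emeasure_translation_diff_small\<close>, sums by the triangle inequality, and limits by
  approximation in L^1, because translation preserves the L^1 distance.\<close>

lemma L1_translation_continuous:
  fixes f :: "'a::euclidean_space \<Rightarrow> 'b::{banach, second_countable_topology}"
  assumes "integrable lborel f" and t: "t \<longlonglongrightarrow> 0" and "(e::real) > 0"
  shows "\<forall>\<^sub>F n in sequentially. (\<integral>\<^sup>+ x. ennreal (norm (f (x + t n) - f x)) \<partial>lborel) \<le> ennreal e"
  using assms(1,3)
proof (induction f arbitrary: e rule: integrable_induct)
  case (base A c)
  then have A [measurable]: "A \<in> sets borel" by simp
  \<comment> \<open>Each half of a symmetric difference will contribute at most \<open>d\<close>, so
    \<open>2 * d * norm c\<close> has to stay below \<open>e\<close>; the \<open>+ 1\<close> keeps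
    the denominator positive for \<open>c = 0\<close>.\<close>
  define d where "d = e / (2 * (norm c + 1))"
  have d: "d > 0" using base by (auto simp: d_def add_nonneg_pos)
  \<comment> \<open>The integrand lives where exactly one of \<open>x\<close> and
    \<open>x + t n\<close> is in \<open>A\<close>. In the case of \<open>x + t n\<close>, the point
    \<open>y = x + t n\<close> lies in \<open>A\<close> while \<open>y - t n\<close> does not, so
    the same estimate is needed for the sequence \<open>- t\<close>.\<close>
  have mt: "(\<lambda>n. - t n) \<longlonglongrightarrow> 0" using tendsto_minus[OF t] by simp
  from emeasure_translation_diff_small[OF A base(2) t d] emeasure_translation_diff_small[OF A base(2) mt d]
  show ?case
  proof eventually_elim
    case (elim n)
    have "(\<integral>\<^sup>+ x. ennreal (norm (indicator A (x + t n) *\<^sub>R c - indicator A x *\<^sub>R c)) \<partial>lborel)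
      = (\<integral>\<^sup>+ x. ennreal (norm c) * (indicator {x \<in> A. x + t n \<notin> A} x
            + indicator {x \<in> A. x + - t n \<notin> A} (x + t n)) \<partial>lborel)"
      by (intro nn_integral_cong) (auto simp: indicator_def)
    also have "\<dots> = ennreal (norm c) * (emeasure lborel {x \<in> A. x + t n \<notin> A} + emeasure lborel {x \<in> A. x + - t n \<notin> A})"
      using nn_integral_lborel_translate[of "indicator {x \<in> A. x + - t n \<notin> A}" "t n"]
      by (subst nn_integral_cmult, simp, subst nn_integral_add) simp_all
    also have "\<dots> \<le> ennreal (norm c) * (ennreal d + ennreal d)"
      by (intro mult_left_mono add_mono elim) auto
    also have "\<dots> = ennreal (norm c * (2 * d))" using d by (simp add: ennreal_mult' flip: ennreal_plus)
    also have "\<dots> \<le> ennreal e"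
    proof (rule ennreal_leI)
      have "norm c * (2 * d) = e * (norm c / (norm c + 1))"
        unfolding d_def using norm_ge_zero[of c] by (simp add: divide_simps)
      also have "\<dots> \<le> e * 1"
        using \<open>e > 0\<close> by (intro mult_left_mono) (auto simp: divide_le_eq_1 add_nonneg_pos)
      finally show "norm c * (2 * d) \<le> e" by simp
    qed
    finally show ?case .
  qed
next
  case (add f g)
  have [measurable]: "f \<in> borel_measurable borel" "g \<in> borel_measurable borel"
    using add.hyps by auto
  have "e/2 > 0" using add by simp
  from add.IH(1)[OF this] add.IH(2)[OF this] show ?case
  proof eventually_elim
    case (elim n)
    have "(\<integral>\<^sup>+ x. ennreal (norm (f (x + t n) + g (x + t n) - (f x + g x))) \<partial>lborel)
      \<le> (\<integral>\<^sup>+ x. ennreal (norm (f (x + t n) - f x)) + ennreal (norm (g (x + t n) - g x)) \<partial>lborel)"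
      by (intro nn_integral_mono) (simp add: norm_diff_triangle_ineq flip: ennreal_plus)
    also have "\<dots> = (\<integral>\<^sup>+ x. ennreal (norm (f (x + t n) - f x)) \<partial>lborel) + (\<integral>\<^sup>+ x. ennreal (norm (g (x + t n) - g x)) \<partial>lborel)"
      by (rule nn_integral_add) simp_all
    also have "\<dots> \<le> ennreal (e/2) + ennreal (e/2)" by (intro add_mono elim)
    also have "\<dots> = ennreal e" using add(5) by (simp flip: ennreal_plus)
    finally show ?case .
  qed
next
  case (lim f s)
  have [measurable]: "f \<in> borel_measurable borel" "\<And>i. s i \<in> borel_measurable borel"
    using lim.hyps(1,4) by auto
  have e3: "e/3 > 0" using lim by simp
  \<comment> \<open>The induction rule supplies \<open>norm (s i x) \<le> 2 * norm (f x)\<close>,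
    hence the majorant. One approximant within \<open>e/3\<close> suffices: its error occurs at
    \<open>x\<close> and at \<open>x + t n\<close>, with equal integrals.\<close>
  have "(\<lambda>i. \<integral>\<^sup>+ x. ennreal (norm (f x - s i x)) \<partial>lborel) \<longlonglongrightarrow> 0"
    by (rule nn_integral_dominated_convergence_norm[where w = "\<lambda>x. 2 * norm (f x)"])
      (use lim integrableD(2)[OF integrable_norm[OF integrable_mult_right[OF integrable_norm[OF lim.hyps(4)], of 2]]] in \<open>auto simp: less_top\<close>)
  then have "\<forall>\<^sub>F i in sequentially. (\<integral>\<^sup>+ x. ennreal (norm (f x - s i x)) \<partial>lborel) < ennreal (e/3)"
    using e3 by (intro order_tendstoD) auto
  then obtain i where i: "(\<integral>\<^sup>+ x. ennreal (norm (f x - s i x)) \<partial>lborel) < ennreal (e/3)"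
    by (auto dest: eventually_happens)
  from lim.IH[OF e3, of i] show ?case
  proof eventually_elim
    case (elim n)
    have "(\<integral>\<^sup>+ x. ennreal (norm (f (x + t n) - f x)) \<partial>lborel)
      \<le> (\<integral>\<^sup>+ x. ennreal (norm (s i (x + t n) - s i x)) + (ennreal (norm (f (x + t n) - s i (x + t n))) + ennreal (norm (f x - s i x))) \<partial>lborel)"
    proof (intro nn_integral_mono)
      fix x
      have "f (x + t n) - f x = (s i (x + t n) - s i x) + ((f (x + t n) - s i (x + t n)) - (f x - s i x))" by simp
      then have "norm (f (x + t n) - f x) \<le> norm (s i (x + t n) - s i x) + (norm (f (x + t n) - s i (x + t n)) + norm (f x - s i x))"
        by (smt (verit) norm_triangle_ineq norm_triangle_ineq4)
      then show "ennreal (norm (f (x + t n) - f x)) \<le> ennreal (norm (s i (x + t n) - s i x)) + (ennreal (norm (f (x + t n) - s i (x + t n))) + ennreal (norm (f x - s i x)))"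
        by (simp flip: ennreal_plus)
    qed
    also have "\<dots> = (\<integral>\<^sup>+ x. ennreal (norm (s i (x + t n) - s i x)) \<partial>lborel)
        + ((\<integral>\<^sup>+ x. ennreal (norm (f x - s i x)) \<partial>lborel) + (\<integral>\<^sup>+ x. ennreal (norm (f x - s i x)) \<partial>lborel))"
      using nn_integral_lborel_translate[of "\<lambda>x. ennreal (norm (f x - s i x))" "t n"]
      by (simp add: nn_integral_add)
    also have "\<dots> \<le> ennreal (e/3) + (ennreal (e/3) + ennreal (e/3))"
      using i by (intro add_mono elim) auto
    also have "\<dots> = ennreal e" using e3 by (simp flip: ennreal_plus)
    finally show ?case .
  qed
qed

text \<open>The Mazur map \<open>h \<mapsto> |h| h\<close> takes \<open>L\<^sup>2\<close> to \<open>L\<^sup>1\<close>, and this bound makes its inverse continuous.\<close>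

lemma norm_diff_sq_le_Mazur:
  fixes a b :: "'a::real_inner"
  shows "(norm (a - b))\<^sup>2 \<le> 2 * norm (norm a *\<^sub>R a - norm b *\<^sub>R b)"
proof (cases "a = b")
  case False
  let ?u = "norm a *\<^sub>R a - norm b *\<^sub>R b"
  have ab: "a \<bullet> b = ((norm a)\<^sup>2 + (norm b)\<^sup>2 - (norm (a - b))\<^sup>2) / 2"
    by (simp add: power2_norm_eq_inner inner_diff_left inner_diff_right inner_commute)
  \<comment> \<open>Pairing \<open>?u\<close> with \<open>a - b\<close> yields two nonnegative
    squares with weight \<open>(norm a + norm b) / 2\<close>. Only the square of
    \<open>norm (a - b)\<close> is kept, and Cauchy-Schwarz bounds the pairing from above.\<close>
  have "?u \<bullet> (a - b) = norm a * (norm a)\<^sup>2 + norm b * (norm b)\<^sup>2 - (norm a + norm b) * (a \<bullet> b)"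
    by (simp add: power2_norm_eq_inner inner_diff_left inner_diff_right inner_commute algebra_simps)
  also have "\<dots> = (norm a + norm b) * (norm (a - b))\<^sup>2 / 2 + (norm a + norm b) * (norm a - norm b)\<^sup>2 / 2"
    unfolding ab by (simp add: field_simps power2_eq_square)
  finally have "?u \<bullet> (a - b) \<ge> (norm a + norm b) * (norm (a - b))\<^sup>2 / 2"
    by simp
  moreover have "(norm a + norm b) * (norm (a - b))\<^sup>2 \<ge> norm (a - b) * (norm (a - b))\<^sup>2"
    by (intro mult_right_mono norm_triangle_ineq4) auto
  moreover have "?u \<bullet> (a - b) \<le> norm ?u * norm (a - b)"
    by (rule norm_cauchy_schwarz)
  ultimately have "norm (a - b) * (norm (a - b))\<^sup>2 \<le> norm (a - b) * (2 * norm ?u)"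
    by (simp add: mult.commute)
  then show ?thesis using False by simp
qed simp

text \<open>The function \<open>u = |h| h\<close> satisfies \<open>|u| = |h|^2\<close> and is
  therefore integrable. Its L^1 continuity, used with \<open>e/2\<close>, comes back to
  \<open>h\<close> through \<open>norm_diff_sq_le_Mazur\<close>, whose factor 2 is thus
  absorbed.\<close>

lemma L2_translation_continuous:
  fixes h :: "'a::euclidean_space \<Rightarrow> 'b::euclidean_space"
  assumes h [measurable]: "h \<in> borel_measurable borel"
    and h2: "integrable lborel (\<lambda>x. (norm (h x))\<^sup>2)" and t: "t \<longlonglongrightarrow> 0" and e: "(e::real) > 0"
  shows "\<forall>\<^sub>F n in sequentially. (\<integral>\<^sup>+ x. ennreal ((norm (h (x + t n) - h x))\<^sup>2) \<partial>lborel) \<le> ennreal e"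
proof -
  define u where "u x = norm (h x) *\<^sub>R h x" for x
  have [measurable]: "u \<in> borel_measurable borel" unfolding u_def by measurable
  have "integrable lborel u"
    using h2 by (rule Bochner_Integration.integrable_bound) (auto simp: u_def power2_eq_square)
  from L1_translation_continuous[OF this t, of "e/2"] e
  have "\<forall>\<^sub>F n in sequentially. (\<integral>\<^sup>+ x. ennreal (norm (u (x + t n) - u x)) \<partial>lborel) \<le> ennreal (e/2)" by simp
  then show ?thesis
  proof eventually_elim
    case (elim n)
    have "(\<integral>\<^sup>+ x. ennreal ((norm (h (x + t n) - h x))\<^sup>2) \<partial>lborel) \<le> (\<integral>\<^sup>+ x. 2 * ennreal (norm (u (x + t n) - u x)) \<partial>lborel)"
    proof (rule nn_integral_mono)
      fix x show "ennreal ((norm (h (x + t n) - h x))\<^sup>2) \<le> 2 * ennreal (norm (u (x + t n) - u x))"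
        using ennreal_leI[OF norm_diff_sq_le_Mazur[of "h (x + t n)" "h x"]] by (simp add: u_def ennreal_mult')
    qed
    also have "\<dots> = 2 * (\<integral>\<^sup>+ x. ennreal (norm (u (x + t n) - u x)) \<partial>lborel)" by (rule nn_integral_cmult) simp
    also have "\<dots> \<le> 2 * ennreal (e/2)" by (intro mult_left_mono elim) auto
    also have "\<dots> = ennreal (2 * (e/2))" by (subst ennreal_mult') auto
    also have "\<dots> = ennreal e" by simp
    finally show ?case .
  qed
qed

section \<open>Autocorrelation of a square-integrable function\<close>

text \<open>The majorant is \<open>(|h(x)|^2 + |h(x + t)|^2) / 2\<close>, whose integral does not
  depend on \<open>t\<close> by translation invariance. Expanding \<open>|h(x + t) - h(x)|^2\<close>
  gives the last identity, which reduces continuity at shift 0 to continuity of translation in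
  L^2.\<close>

lemma
  fixes h :: "'a::euclidean_space \<Rightarrow> 'b::euclidean_space"
  assumes h [measurable]: "h \<in> borel_measurable borel"
    and h2: "integrable lborel (\<lambda>x. (norm (h x))\<^sup>2)"
  shows integrable_autocorrelation: "integrable lborel (\<lambda>x. h x \<bullet> h (x + t))"
    and integral_norm_autocorrelation_le: "(\<integral> x. norm (h x \<bullet> h (x + t)) \<partial>lborel) \<le> (\<integral> x. (norm (h x))\<^sup>2 \<partial>lborel)"
    and autocorrelation_eq: "(\<integral> x. h x \<bullet> h (x + t) \<partial>lborel) = (\<integral> x. (norm (h x))\<^sup>2 \<partial>lborel) - (\<integral> x. (norm (h (x + t) - h x))\<^sup>2 \<partial>lborel) / 2"
proof -
  have h2t: "integrable lborel (\<lambda>x. (norm (h (x + t)))\<^sup>2)"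
    using integrable_lborel_translate[of "\<lambda>x. (norm (h x))\<^sup>2" t] h2 by simp
  have eq: "(\<integral> x. (norm (h (x + t)))\<^sup>2 \<partial>lborel) = (\<integral> x. (norm (h x))\<^sup>2 \<partial>lborel)"
    using integral_lborel_translate[of "\<lambda>x. (norm (h x))\<^sup>2" t] by simp
  have bd: "norm (h x \<bullet> h (x + t)) \<le> ((norm (h x))\<^sup>2 + (norm (h (x + t)))\<^sup>2) / 2" for x
    using Cauchy_Schwarz_ineq2[of "h x" "h (x + t)"] sum_squares_bound[of "norm (h x)" "norm (h (x + t))"] by simp
  have int: "integrable lborel (\<lambda>x. ((norm (h x))\<^sup>2 + (norm (h (x + t)))\<^sup>2) / 2)"
    using h2 h2t by simp
  show 1: "integrable lborel (\<lambda>x. h x \<bullet> h (x + t))"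
    using int by (rule Bochner_Integration.integrable_bound) (use bd in \<open>auto simp: abs_of_nonneg\<close>)
  have "(\<integral> x. norm (h x \<bullet> h (x + t)) \<partial>lborel) \<le> (\<integral> x. ((norm (h x))\<^sup>2 + (norm (h (x + t)))\<^sup>2) / 2 \<partial>lborel)"
    by (intro integral_mono int integrable_norm 1 bd)
  also have "\<dots> = (\<integral> x. (norm (h x))\<^sup>2 \<partial>lborel)" using h2 h2t eq by simp
  finally show "(\<integral> x. norm (h x \<bullet> h (x + t)) \<partial>lborel) \<le> (\<integral> x. (norm (h x))\<^sup>2 \<partial>lborel)" .
  have "(norm (h (x + t) - h x))\<^sup>2 = (norm (h x))\<^sup>2 + (norm (h (x + t)))\<^sup>2 - 2 * (h x \<bullet> h (x + t))" for x
    by (simp add: power2_norm_eq_inner inner_diff_left inner_diff_right inner_commute)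
  then have "(\<integral> x. (norm (h (x + t) - h x))\<^sup>2 \<partial>lborel) = 2 * (\<integral> x. (norm (h x))\<^sup>2 \<partial>lborel) - 2 * (\<integral> x. h x \<bullet> h (x + t) \<partial>lborel)"
    using h2 h2t 1 eq by simp
  then show "(\<integral> x. h x \<bullet> h (x + t) \<partial>lborel) = (\<integral> x. (norm (h x))\<^sup>2 \<partial>lborel) - (\<integral> x. (norm (h (x + t) - h x))\<^sup>2 \<partial>lborel) / 2"
    by (simp add: field_simps)
qed

lemma autocorrelation_tendsto:
  fixes h :: "'a::euclidean_space \<Rightarrow> 'b::euclidean_space"
  assumes h [measurable]: "h \<in> borel_measurable borel"
    and h2: "integrable lborel (\<lambda>x. (norm (h x))\<^sup>2)" and t: "t \<longlonglongrightarrow> 0"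
  shows "(\<lambda>n. \<integral> x. h x \<bullet> h (x + t n) \<partial>lborel) \<longlonglongrightarrow> (\<integral> x. (norm (h x))\<^sup>2 \<partial>lborel)"
proof -
  have "(\<lambda>n. \<integral> x. (norm (h (x + t n) - h x))\<^sup>2 \<partial>lborel) \<longlonglongrightarrow> 0"
  proof (rule tendstoI)
    fix e :: real assume "e > 0"
    then have "\<forall>\<^sub>F n in sequentially. (\<integral>\<^sup>+ x. ennreal ((norm (h (x + t n) - h x))\<^sup>2) \<partial>lborel) \<le> ennreal (e/2)"
      by (intro L2_translation_continuous[OF h h2 t]) simp
    then show "\<forall>\<^sub>F n in sequentially. dist (\<integral> x. (norm (h (x + t n) - h x))\<^sup>2 \<partial>lborel) 0 < e"
    proof eventually_elim
      case (elim n)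
      have "(\<integral> x. (norm (h (x + t n) - h x))\<^sup>2 \<partial>lborel) = enn2real (\<integral>\<^sup>+ x. ennreal ((norm (h (x + t n) - h x))\<^sup>2) \<partial>lborel)"
        by (rule integral_eq_nn_integral) auto
      also have "\<dots> \<le> e/2" using elim \<open>e > 0\<close> by (intro enn2real_leI) auto
      finally show ?case using \<open>e > 0\<close> by (simp add: abs_of_nonneg)
    qed
  qed
  then have "(\<lambda>n. (\<integral> x. (norm (h x))\<^sup>2 \<partial>lborel) - (\<integral> x. (norm (h (x + t n) - h x))\<^sup>2 \<partial>lborel) / 2)
     \<longlonglongrightarrow> (\<integral> x. (norm (h x))\<^sup>2 \<partial>lborel) - 0 / 2"
    by (intro tendsto_intros) simp_all
  then show ?thesis by (simp add: autocorrelation_eq[OF h h2])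
qed

subsection \<open>Rotations of quaternions by exponentials on both sides\<close>

text \<open>Euler's formula for any square root of -1: the product
  \<open>exp (t u) (cos t - u sin t)\<close> has derivative zero and value 1 at 0, and
  \<open>cos t + u sin t\<close> is inverse to the second factor.\<close>

lemma exp_scaleR_quat_unit:
  fixes u :: quat
  assumes u: "u * u = -1"
  shows "exp (r *\<^sub>R u) = cos r *\<^sub>R 1 + sin r *\<^sub>R u"
proof -
  define y where "y t = exp (t *\<^sub>R u) * (cos t *\<^sub>R 1 - sin t *\<^sub>R u)" for t
  have "(y has_vector_derivative 0) (at t)" for t
  proof -
    have "(y has_vector_derivative (exp (t *\<^sub>R u) * ((- sin t) *\<^sub>R 1 - cos t *\<^sub>R u)
        + (exp (t *\<^sub>R u) * u) * (cos t *\<^sub>R 1 - sin t *\<^sub>R u))) (at t)"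
      unfolding y_def
      by (rule has_vector_derivative_mult exp_scaleR_has_vector_derivative_right derivative_eq_intros refl | simp)+
    moreover have "exp (t *\<^sub>R u) * ((- sin t) *\<^sub>R 1 - cos t *\<^sub>R u)
        + (exp (t *\<^sub>R u) * u) * (cos t *\<^sub>R 1 - sin t *\<^sub>R u) = 0"
      by (simp add: algebra_simps mult.assoc u)
    ultimately show ?thesis by simp
  qed
  then have "(y has_derivative (\<lambda>h. 0)) (at t within UNIV)" for t
    by (simp add: has_vector_derivative_def)
  then obtain c where c: "y t = c" for t
    using has_derivative_zero_constant[of UNIV y] by auto
  from c[of 0] have "c = 1" by (simp add: y_def)
  then have 1: "exp (r *\<^sub>R u) * (cos r *\<^sub>R 1 - sin r *\<^sub>R u) = 1"
    using c[of r] by (simp add: y_def)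
  have 2: "(cos r *\<^sub>R 1 - sin r *\<^sub>R u) * (cos r *\<^sub>R 1 + sin r *\<^sub>R u) = 1"
  proof -
    have "(cos r *\<^sub>R 1 - sin r *\<^sub>R u) * (cos r *\<^sub>R 1 + sin r *\<^sub>R u) = (cos r * cos r) *\<^sub>R 1 + (sin r * sin r) *\<^sub>R (1::quat)"
      by (simp add: algebra_simps u)
    then show ?thesis by (simp flip: scaleR_left_distrib power2_eq_square)
  qed
  have "exp (r *\<^sub>R u) = exp (r *\<^sub>R u) * ((cos r *\<^sub>R 1 - sin r *\<^sub>R u) * (cos r *\<^sub>R 1 + sin r *\<^sub>R u))"
    by (simp only: 2 mult_1_right)
  also have "\<dots> = cos r *\<^sub>R 1 + sin r *\<^sub>R u"
    by (simp only: mult.assoc[symmetric] 1 mult_1_left)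
  finally show ?thesis .
qed

lemma quat_i_sel [simp]: "qre quat_i = 0" "qim1 quat_i = 1" "qim2 quat_i = 0" "qim3 quat_i = 0"
  and quat_j_sel [simp]: "qre quat_j = 0" "qim1 quat_j = 0" "qim2 quat_j = 1" "qim3 quat_j = 0"
  by (simp_all add: quat_i_def quat_j_def)

text \<open>Both kernel factors are packaged as one linear isometry of the quaternions indexed by a
  pair of angles. Noncommutativity is hidden in this map, which behaves like a unitary character of
  the plane.\<close>

definition quat_rot :: "real \<times> real \<Rightarrow> quat \<Rightarrow> quat"
  where "quat_rot a q = exp ((- fst a) *\<^sub>R quat_i) * q * exp ((- snd a) *\<^sub>R quat_j)"

text \<open>The product of two Euler formulas, with real trigonometric coefficients separated from
  fixed quaternions. It serves joint continuity in \<open>a\<close> and \<open>q\<close> and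
  coefficientwise integration against the Gaussian.\<close>

lemma quat_rot_eq:
  "quat_rot a q = (cos (fst a) * cos (snd a)) *\<^sub>R q - (sin (fst a) * cos (snd a)) *\<^sub>R (quat_i * q)
     - (cos (fst a) * sin (snd a)) *\<^sub>R (q * quat_j) + (sin (fst a) * sin (snd a)) *\<^sub>R (quat_i * q * quat_j)"
  unfolding quat_rot_def
  by (simp only: exp_scaleR_quat_unit[OF quat_units(1)] exp_scaleR_quat_unit[OF quat_units(2)])
     (simp add: algebra_simps)

lemma norm_quat_rot [simp]: "norm (quat_rot a q) = norm q"
proof -
  have "norm (exp (r *\<^sub>R quat_i)) = 1" "norm (exp (r *\<^sub>R quat_j)) = 1" for r
    by (simp_all add: exp_scaleR_quat_unit quat_units quat_norm_eq)
  then show ?thesis by (simp only: quat_rot_def norm_mult mult_1_left mult_1_right)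
qed

text \<open>The two factors act on opposite sides of \<open>q\<close>, and exponentials on one side
  involve a single unit and hence commute.\<close>

lemma quat_rot_add: "quat_rot (a + b) q = quat_rot a (quat_rot b q)"
proof -
  have "exp ((- fst (a + b)) *\<^sub>R quat_i) = exp ((- fst a) *\<^sub>R quat_i) * exp ((- fst b) *\<^sub>R quat_i)"
    by (subst exp_add_commuting[symmetric]) (auto simp: algebra_simps)
  moreover have "exp ((- snd (a + b)) *\<^sub>R quat_j) = exp ((- snd b) *\<^sub>R quat_j) * exp ((- snd a) *\<^sub>R quat_j)"
    by (subst exp_add_commuting[symmetric]) (auto simp: algebra_simps)
  ultimately show ?thesis unfolding quat_rot_def by (simp only: mult.assoc)
qed

lemma quat_rot_0 [simp]: "quat_rot 0 q = q"
  by (simp add: quat_rot_def)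

lemma bounded_linear_quat_rot: "bounded_linear (quat_rot a)"
proof (rule bounded_linear_intro[where K = 1])
  show "quat_rot a (p + q) = quat_rot a p + quat_rot a q" for p q by (simp add: quat_rot_def algebra_simps)
  show "quat_rot a (r *\<^sub>R q) = r *\<^sub>R quat_rot a q" for r q by (simp add: quat_rot_def)
qed simp

text \<open>A linear isometry preserves inner products by polarization, and
  \<open>quat_rot (- a)\<close> inverts \<open>quat_rot a\<close>; so it is also the adjoint. This
  moves the kernel from one factor of an inner product to the other.\<close>

lemma inner_quat_rot: "quat_rot a p \<bullet> q = p \<bullet> quat_rot (- a) q"
proof -
  have iso: "quat_rot a x \<bullet> quat_rot a y = x \<bullet> y" for x y
  proof -
    have "(norm (quat_rot a x + quat_rot a y))\<^sup>2 = (norm (x + y))\<^sup>2"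
      by (simp flip: linear_simps(1)[OF bounded_linear_quat_rot])
    then show ?thesis
      by (simp add: norm_quat_rot power2_norm_eq_inner inner_add_left inner_add_right inner_commute)
         (simp flip: power2_norm_eq_inner)
  qed
  have "quat_rot a (quat_rot (- a) q) = q" by (simp flip: quat_rot_add)
  then show ?thesis using iso[of p "quat_rot (- a) q"] by simp
qed

lemma measurable_quat_rot [measurable (raw)]:
  assumes [measurable]: "f \<in> borel_measurable M" "g \<in> borel_measurable M"
  shows "(\<lambda>x. quat_rot (f x) (g x)) \<in> borel_measurable M"
proof -
  have "(\<lambda>p::(real\<times>real)\<times>quat. quat_rot (fst p) (snd p)) \<in> borel_measurable borel"
    unfolding quat_rot_eq by (intro borel_measurable_continuous_onI continuous_intros)
  from measurable_compose[OF _ this, of "\<lambda>x. (f x, g x)" M] show ?thesis by simp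
qed

subsection \<open>Gaussian integrals on the plane\<close>

text \<open>Real and imaginary part of the characteristic function of the standard normal
  distribution.\<close>

lemma
  shows std_normal_cos: "(\<integral>x. std_normal_density x * cos (t * x) \<partial>lborel) = exp (- t\<^sup>2 / 2)"
    and std_normal_sin: "(\<integral>x. std_normal_density x * sin (t * x) \<partial>lborel) = 0"
proof -
  have "char std_normal_distribution t = (\<integral>x. std_normal_density x *\<^sub>R iexp (t * x) \<partial>lborel)"
    unfolding char_def by (subst integral_density) auto
  then have eq: "(\<integral>x. std_normal_density x *\<^sub>R iexp (t * x) \<partial>lborel) = complex_of_real (exp (- t\<^sup>2 / 2))"
    by (simp add: char_std_normal_distribution)
  have int: "integrable lborel (\<lambda>x. std_normal_density x *\<^sub>R iexp (t * x))"
    by (rule Bochner_Integration.integrable_bound[OF integrable_normal_density[of 1 0]]) auto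
  have "(\<integral>x. std_normal_density x * cos (t * x) \<partial>lborel) = Re (\<integral>x. std_normal_density x *\<^sub>R iexp (t * x) \<partial>lborel)"
    by (subst integral_Re[OF int, symmetric]) (simp add: Re_exp)
  then show "(\<integral>x. std_normal_density x * cos (t * x) \<partial>lborel) = exp (- t\<^sup>2 / 2)" by (simp only: eq Re_complex_of_real Im_complex_of_real)
  have "(\<integral>x. std_normal_density x * sin (t * x) \<partial>lborel) = Im (\<integral>x. std_normal_density x *\<^sub>R iexp (t * x) \<partial>lborel)"
    by (subst integral_Im[OF int, symmetric]) (simp add: Im_exp)
  then show "(\<integral>x. std_normal_density x * sin (t * x) \<partial>lborel) = 0" by (simp only: eq Re_complex_of_real Im_complex_of_real)
qed

lemma (in pair_sigma_finite)
  fixes a :: "'a \<Rightarrow> real" and b :: "'b \<Rightarrow> 'c::{banach, second_countable_topology}"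
  assumes a: "integrable M1 a" and b: "integrable M2 b"
  shows integrable_prod_scaleR: "integrable (M1 \<Otimes>\<^sub>M M2) (\<lambda>p. a (fst p) *\<^sub>R b (snd p))"
    and integral_prod_scaleR: "(\<integral>p. a (fst p) *\<^sub>R b (snd p) \<partial>(M1 \<Otimes>\<^sub>M M2)) = (\<integral>x. a x \<partial>M1) *\<^sub>R (\<integral>y. b y \<partial>M2)"
proof -
  have [measurable]: "a \<in> borel_measurable M1" "b \<in> borel_measurable M2" using a b by auto
  show 1: "integrable (M1 \<Otimes>\<^sub>M M2) (\<lambda>p. a (fst p) *\<^sub>R b (snd p))"
    by (rule Fubini_integrable) (use a b in simp_all)
  show "(\<integral>p. a (fst p) *\<^sub>R b (snd p) \<partial>(M1 \<Otimes>\<^sub>M M2)) = (\<integral>x. a x \<partial>M1) *\<^sub>R (\<integral>y. b y \<partial>M2)"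
    using integral_fst'[OF 1] a b by simp
qed

lemma
  fixes f :: "'a::euclidean_space \<Rightarrow> 'b::{banach, second_countable_topology}"
  assumes [measurable]: "f \<in> borel_measurable borel" and c: "c > 0"
  shows integrable_lborel_scale: "integrable lborel (\<lambda>x. f (c *\<^sub>R x)) \<longleftrightarrow> integrable lborel f"
    and integral_lborel_scale: "(\<integral>x. f x \<partial>lborel) = c ^ DIM('a) *\<^sub>R (\<integral>x. f (c *\<^sub>R x) \<partial>lborel)"
proof -
  have eq: "(lborel :: 'a measure) = density (distr lborel borel (\<lambda>x. c *\<^sub>R x)) (\<lambda>_. ennreal (c ^ DIM('a)))"
    using lborel_affine[of c "0::'a"] c by simp
  have "integrable lborel f \<longleftrightarrow> integrable (density (distr lborel borel (\<lambda>x. c *\<^sub>R x)) (\<lambda>_. ennreal (c ^ DIM('a)))) f"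
    by (simp only: eq[symmetric])
  also have "\<dots> \<longleftrightarrow> integrable lborel (\<lambda>x. f (c *\<^sub>R x))"
    using c by (simp add: integrable_density integrable_distr_eq) (use integrable_scaleR_right[of "inverse (c ^ DIM('a))" lborel "\<lambda>x. c ^ DIM('a) *\<^sub>R f (c *\<^sub>R x)"] in auto)
  finally show "integrable lborel (\<lambda>x. f (c *\<^sub>R x)) \<longleftrightarrow> integrable lborel f" ..
  have "(\<integral>x. f x \<partial>lborel) = (\<integral>x. f x \<partial>density (distr lborel borel (\<lambda>x. c *\<^sub>R x)) (\<lambda>_. ennreal (c ^ DIM('a))))"
    by (simp only: eq[symmetric])
  also have "\<dots> = c ^ DIM('a) *\<^sub>R (\<integral>x. f (c *\<^sub>R x) \<partial>lborel)"
    using c by (simp add: integral_density integral_distr)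
  finally show "(\<integral>x. f x \<partial>lborel) = c ^ DIM('a) *\<^sub>R (\<integral>x. f (c *\<^sub>R x) \<partial>lborel)" .
qed

section \<open>The planar Gaussian and its two-sided transform\<close>

text \<open>The standard normal density on the plane, of total mass 1; up to scaling it is its own
  Fourier transform.\<close>

definition gauss :: "real \<times> real \<Rightarrow> real"
  where "gauss s = exp (- (norm s)\<^sup>2 / 2) / (2 * pi)"

lemma gauss_eq: "gauss s = std_normal_density (fst s) * std_normal_density (snd s)"
proof -
  have "sqrt (2 * pi) * sqrt (2 * pi) = 2 * pi" by simp
  then show ?thesis
    by (cases s) (simp add: gauss_def std_normal_density_def norm_prod_def exp_add[symmetric] add_divide_distrib del: real_sqrt_mult)
qed

lemma gauss_pos: "gauss s > 0"
  by (simp add: gauss_def)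

lemma gauss_bound: "gauss s \<le> 1"
proof -
  have "exp (- (norm s)\<^sup>2 / 2) \<le> 1" by simp
  also have "1 \<le> 2 * pi" using pi_ge_two by simp
  finally show ?thesis by (simp add: gauss_def)
qed

lemma measurable_gauss [measurable]: "gauss \<in> borel_measurable borel"
  unfolding gauss_def[abs_def] by measurable

text \<open>The planar Gaussian factors over the coordinates, so Fubini splits the integral. The
  vector \<open>q\<close> stands for the fixed quaternion products in
  \<open>quat_rot_eq\<close>.\<close>

lemma
  fixes q :: "'b::{banach, second_countable_topology}"
  assumes "integrable lborel (\<lambda>x. std_normal_density x * a x)" "integrable lborel (\<lambda>x. std_normal_density x * b x)"
  shows integrable_gauss_prod: "integrable lborel (\<lambda>s. gauss s *\<^sub>R (a (fst s) * b (snd s)) *\<^sub>R q)"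
    and integral_gauss_prod: "(\<integral>s. gauss s *\<^sub>R (a (fst s) * b (snd s)) *\<^sub>R q \<partial>lborel)
    = ((\<integral>x. std_normal_density x * a x \<partial>lborel) * (\<integral>x. std_normal_density x * b x \<partial>lborel)) *\<^sub>R q"
proof -
  have *: "gauss s *\<^sub>R (a (fst s) * b (snd s)) *\<^sub>R q
     = (std_normal_density (fst s) * a (fst s)) *\<^sub>R ((std_normal_density (snd s) * b (snd s)) *\<^sub>R q)" for s
    by (simp add: gauss_eq mult_ac)
  note b = integrable_scaleR_left[where c=q, OF assms(2)]
  show "integrable lborel (\<lambda>s. gauss s *\<^sub>R (a (fst s) * b (snd s)) *\<^sub>R q)"
    using lborel_pair.integrable_prod_scaleR[OF assms(1) b] unfolding * lborel_prod .
  show "(\<integral>s. gauss s *\<^sub>R (a (fst s) * b (snd s)) *\<^sub>R q \<partial>lborel)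
    = ((\<integral>x. std_normal_density x * a x \<partial>lborel) * (\<integral>x. std_normal_density x * b x \<partial>lborel)) *\<^sub>R q"
    using lborel_pair.integral_prod_scaleR[OF assms(1) b] assms(2) unfolding * lborel_prod by simp
qed

lemma integrable_gauss: "integrable lborel gauss" and integral_gauss: "(\<integral>s. gauss s \<partial>lborel) = 1"
  using integrable_gauss_prod[of "\<lambda>_. 1" "\<lambda>_. 1" "1::real"] integral_gauss_prod[of "\<lambda>_. 1" "\<lambda>_. 1" "1::real"]
  by simp_all

text \<open>The pair of angles at which \<open>quat_rot\<close> becomes the Fourier kernel. It is
  bilinear, so a difference of positions turns into a composition of rotations.\<close>

definition phase :: "real \<times> real \<Rightarrow> real \<times> real \<Rightarrow> real \<times> real"
  where "phase x \<omega> = (2 * pi * fst x * fst \<omega>, 2 * pi * snd x * snd \<omega>)"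

lemma phase_diff: "phase (y - x) \<omega> = - phase x \<omega> + phase y \<omega>"
  by (simp add: phase_def algebra_simps)

lemma measurable_phase [measurable (raw)]:
  assumes [measurable]: "f \<in> borel_measurable M" "g \<in> borel_measurable M"
  shows "(\<lambda>z. phase (f z) (g z)) \<in> borel_measurable M"
proof -
  have "(\<lambda>p::(real\<times>real)\<times>(real\<times>real). phase (fst p) (snd p)) \<in> borel_measurable borel"
    unfolding phase_def by (intro borel_measurable_continuous_onI continuous_intros)
  from measurable_compose[OF _ this, of "\<lambda>x. (f x, g x)" M] show ?thesis by simp
qed

text \<open>All terms with a sine in the expansion of \<open>quat_rot\<close> integrate to 0 by parity, which is
  why the two-sided transform of a Gaussian acts on \<open>q\<close> as a real scalar.\<close>

lemma integral_gauss_quat_rot: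
  "(\<integral>\<omega>. gauss \<omega> *\<^sub>R quat_rot (phase t \<omega>) q \<partial>lborel) = (2 * pi * gauss ((2 * pi) *\<^sub>R t)) *\<^sub>R q"
proof -
  have ic: "integrable lborel (\<lambda>x. std_normal_density x * cos (u * x))"
   and isn: "integrable lborel (\<lambda>x. std_normal_density x * sin (u * x))" for u :: real
    by (rule Bochner_Integration.integrable_bound[OF integrable_normal_density[of 1 0]];
        auto simp: abs_mult intro!: mult_left_le)+
  define a b where "a = 2 * pi * fst t" and "b = 2 * pi * snd t"
  have eq: "gauss \<omega> *\<^sub>R quat_rot (phase t \<omega>) q =
       gauss \<omega> *\<^sub>R (cos (a * fst \<omega>) * cos (b * snd \<omega>)) *\<^sub>R q
     - gauss \<omega> *\<^sub>R (sin (a * fst \<omega>) * cos (b * snd \<omega>)) *\<^sub>R (quat_i * q)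
     - gauss \<omega> *\<^sub>R (cos (a * fst \<omega>) * sin (b * snd \<omega>)) *\<^sub>R (q * quat_j)
     + gauss \<omega> *\<^sub>R (sin (a * fst \<omega>) * sin (b * snd \<omega>)) *\<^sub>R (quat_i * q * quat_j)" for \<omega>
    unfolding quat_rot_eq phase_def a_def b_def by (simp add: scaleR_right_diff_distrib scaleR_right_distrib)
  note i = integrable_gauss_prod
  note I = integral_gauss_prod
  have "(\<integral>\<omega>. gauss \<omega> *\<^sub>R quat_rot (phase t \<omega>) q \<partial>lborel) = (exp (- a\<^sup>2 / 2) * exp (- b\<^sup>2 / 2)) *\<^sub>R q"
    unfolding eq
    by (subst Bochner_Integration.integral_add Bochner_Integration.integral_diff,
        (intro Bochner_Integration.integrable_add Bochner_Integration.integrable_diff i ic isn)+)+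
       (simp only: I[OF ic ic] I[OF isn ic] I[OF ic isn] I[OF isn isn] std_normal_cos std_normal_sin, simp)
  also have "exp (- a\<^sup>2 / 2) * exp (- b\<^sup>2 / 2) = 2 * pi * gauss ((2 * pi) *\<^sub>R t)"
    by (cases t) (simp add: gauss_eq std_normal_density_def a_def b_def)
  finally show ?thesis .
qed

text \<open>Substituting \<open>c *\<^sub>R \<omega>\<close> has Jacobian \<open>c\<^sup>2\<close>
  in the plane and moves the dilation onto \<open>t\<close>. Of the two factors
  \<open>2 * pi\<close>, one undoes the normalisation of \<open>gauss\<close> and the other comes
  from its transform.\<close>

lemma integral_gauss_scaled_quat_rot:
  assumes c: "c > 0"
  shows "(\<integral>\<omega>. exp (- (norm \<omega>)\<^sup>2 / (2 * c\<^sup>2)) *\<^sub>R quat_rot (phase t \<omega>) q \<partial>lborel)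
    = ((2 * pi * c)\<^sup>2 * gauss ((2 * pi * c) *\<^sub>R t)) *\<^sub>R q"
proof -
  have "(\<integral>\<omega>. exp (- (norm \<omega>)\<^sup>2 / (2 * c\<^sup>2)) *\<^sub>R quat_rot (phase t \<omega>) q \<partial>lborel)
    = c\<^sup>2 *\<^sub>R (\<integral>\<omega>. exp (- (norm (c *\<^sub>R \<omega>))\<^sup>2 / (2 * c\<^sup>2)) *\<^sub>R quat_rot (phase t (c *\<^sub>R \<omega>)) q \<partial>lborel)"
    by (subst integral_lborel_scale[OF _ c]) (simp_all add: power2_eq_square)
  also have "(\<lambda>\<omega>. exp (- (norm (c *\<^sub>R \<omega>))\<^sup>2 / (2 * c\<^sup>2)) *\<^sub>R quat_rot (phase t (c *\<^sub>R \<omega>)) q)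
     = (\<lambda>\<omega>. (2 * pi) *\<^sub>R (gauss \<omega> *\<^sub>R quat_rot (phase (c *\<^sub>R t) \<omega>) q))"
    using c by (intro ext) (simp add: gauss_def phase_def power_mult_distrib mult_ac)
  also have "c\<^sup>2 *\<^sub>R (\<integral>\<omega>. (2 * pi) *\<^sub>R (gauss \<omega> *\<^sub>R quat_rot (phase (c *\<^sub>R t) \<omega>) q) \<partial>lborel)
    = ((2 * pi * c)\<^sup>2 * gauss ((2 * pi * c) *\<^sub>R t)) *\<^sub>R q"
    by (simp only: integral_scaleR_right integral_gauss_quat_rot)
       (simp add: power2_eq_square mult_ac)
  finally show ?thesis .
qed

subsection \<open>Plancherel for the two-sided quaternionic Fourier transform\<close>

text \<open>The integral is over \<open>lborel\<close>, whose products allow Fubini for Borel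
  functions; \<open>gqft_eq_qft\<close> makes the link to the integral over
  \<open>lebesgue\<close>.\<close>

definition qft :: "(real \<times> real \<Rightarrow> quat) \<Rightarrow> real \<times> real \<Rightarrow> quat"
  where "qft h \<omega> = (\<integral>x. quat_rot (phase x \<omega>) (h x) \<partial>lborel)"

lemma measurable_qft [measurable]:
  assumes [measurable]: "h \<in> borel_measurable borel"
  shows "qft h \<in> borel_measurable borel"
  unfolding qft_def[abs_def] by measurable

lemma integrable_quat_rot:
  assumes "integrable M h" and [measurable]: "g \<in> borel_measurable M"
  shows "integrable M (\<lambda>x. quat_rot (g x) (h x))"
  using assms(1) by (rule Bochner_Integration.integrable_bound) (use borel_measurable_integrable[OF assms(1)] in auto)

lemma norm_qft_le:
  "norm (qft h \<omega>) \<le> (\<integral>x. norm (h x) \<partial>lborel)"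
  unfolding qft_def by (rule order_trans[OF integral_norm_bound]) simp

lemma integrable_gauss_weight:
  assumes "c > 0"
  shows "integrable lborel (\<lambda>\<omega>::real \<times> real. exp (- (norm \<omega>)\<^sup>2 / (2 * c\<^sup>2)))"
proof -
  have "(\<lambda>\<omega>::real \<times> real. exp (- (norm (c *\<^sub>R \<omega>))\<^sup>2 / (2 * c\<^sup>2))) = (\<lambda>\<omega>. 2 * pi * gauss \<omega>)"
    using assms by (intro ext) (simp add: gauss_def power_mult_distrib)
  then show ?thesis
    by (subst integrable_lborel_scale[OF _ assms, symmetric]) (simp_all add: integrable_gauss)
qed

text \<open>A product majorant with integrable factors gives the absolute integrability that Fubini
  requires. In the uses below one factor is a Gaussian weight and the other a multiple of
  \<open>norm (h y)\<close>.\<close>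

lemma integral_lborel_swap:
  fixes f :: "'a::euclidean_space \<Rightarrow> 'b::euclidean_space \<Rightarrow> 'c::{banach, second_countable_topology}"
  assumes [measurable]: "case_prod f \<in> borel_measurable (lborel \<Otimes>\<^sub>M lborel)"
    and "integrable lborel a" "integrable lborel b" "\<And>x y. norm (f x y) \<le> a x * b y"
  shows "(\<integral>x. \<integral>y. f x y \<partial>lborel \<partial>lborel) = (\<integral>y. \<integral>x. f x y \<partial>lborel \<partial>lborel)"
proof -
  have "integrable (lborel \<Otimes>\<^sub>M lborel) (case_prod f)"
    by (rule Bochner_Integration.integrable_bound[OF lborel_pair.integrable_prod_scaleR[OF assms(2,3)]])
       (auto intro!: AE_I2 order_trans[OF assms(4) abs_ge_self])
  then show ?thesis by (rule lborel_pair.Fubini_integral[symmetric])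
qed

text \<open>Gaussian-regularised Fourier inversion. The inverse rotation merges with the kernel into
  a rotation by \<open>phase (y - x) \<omega>\<close>; after the swap the integral over \<omega> is
  a real Gaussian factor, which leaves an average of \<open>h\<close> around \<open>x\<close> at
  scale \<open>1 / (2 * pi * c)\<close>.\<close>

lemma integral_gauss_weight_rot_qft:
  assumes h: "integrable lborel h" and c: "c > 0"
  shows "(\<integral>\<omega>. exp (- (norm \<omega>)\<^sup>2 / (2 * c\<^sup>2)) *\<^sub>R quat_rot (- phase x \<omega>) (qft h \<omega>) \<partial>lborel)
     = (\<integral>s. gauss s *\<^sub>R h (x + s /\<^sub>R (2 * pi * c)) \<partial>lborel)"
proof -
  have [measurable]: "h \<in> borel_measurable borel" using h by auto
  let ?W = "\<lambda>\<omega>::real \<times> real. exp (- (norm \<omega>)\<^sup>2 / (2 * c\<^sup>2))"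
  define C where "C = 2 * pi * c"
  have C: "C > 0" using c by (simp add: C_def)
  have "(\<integral>\<omega>. ?W \<omega> *\<^sub>R quat_rot (- phase x \<omega>) (qft h \<omega>) \<partial>lborel)
    = (\<integral>\<omega>. \<integral>y. ?W \<omega> *\<^sub>R quat_rot (phase (y - x) \<omega>) (h y) \<partial>lborel \<partial>lborel)"
  proof (rule Bochner_Integration.integral_cong)
    fix \<omega>
    show "?W \<omega> *\<^sub>R quat_rot (- phase x \<omega>) (qft h \<omega>) = (\<integral>y. ?W \<omega> *\<^sub>R quat_rot (phase (y - x) \<omega>) (h y) \<partial>lborel)"
      unfolding qft_def phase_diff quat_rot_add
      by (subst integral_bounded_linear[OF bounded_linear_quat_rot, symmetric])
         (auto intro!: integrable_quat_rot h)
  qed simp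
  also have "\<dots> = (\<integral>y. \<integral>\<omega>. ?W \<omega> *\<^sub>R quat_rot (phase (y - x) \<omega>) (h y) \<partial>lborel \<partial>lborel)"
    by (rule integral_lborel_swap[OF _ integrable_gauss_weight[OF c] integrable_norm[OF h]]) (auto simp del: scaleR_minus_left)
  also have "\<dots> = (\<integral>y. (C\<^sup>2 * gauss (C *\<^sub>R (y - x))) *\<^sub>R h y \<partial>lborel)"
    unfolding integral_gauss_scaled_quat_rot[OF c] C_def ..
  also have "\<dots> = (\<integral>y. (C\<^sup>2 * gauss (C *\<^sub>R y)) *\<^sub>R h (x + y) \<partial>lborel)"
    by (subst integral_lborel_translate[of _ x, symmetric]) (simp_all add: add.commute)
  \<comment> \<open>Writing \<open>y\<close> as \<open>(C *\<^sub>R y) /\<^sub>R C\<close> prepares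
    the substitution \<open>s = C *\<^sub>R y\<close>, whose Jacobian cancels the prefactor.\<close>
  also have "\<dots> = C\<^sup>2 *\<^sub>R (\<integral>y. gauss (C *\<^sub>R y) *\<^sub>R h (x + (C *\<^sub>R y) /\<^sub>R C) \<partial>lborel)"
    using C by (simp add: scaleR_scaleR[symmetric] del: scaleR_scaleR) (simp add: scaleR_scaleR)
  also have "\<dots> = (\<integral>s. gauss s *\<^sub>R h (x + s /\<^sub>R C) \<partial>lborel)"
    by (subst (2) integral_lborel_scale[OF _ C]) (simp_all add: power2_eq_square)
  finally show ?thesis unfolding C_def .
qed

text \<open>The squared norm is the inner product of \<open>qft h \<omega>\<close> with itself. One
  copy is written as an integral over \<open>x\<close>, its rotation is moved to the other copy by
  adjointness, and regularised inversion evaluates the integral over \<omega>.\<close>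

lemma integral_gauss_weight_qft:
  assumes h: "integrable lborel h" and h2: "integrable lborel (\<lambda>x. (norm (h x))\<^sup>2)" and c: "c > 0"
  shows "(\<integral>\<omega>. exp (- (norm \<omega>)\<^sup>2 / (2 * c\<^sup>2)) * (norm (qft h \<omega>))\<^sup>2 \<partial>lborel)
     = (\<integral>s. gauss s * (\<integral>x. h x \<bullet> h (x + s /\<^sub>R (2 * pi * c)) \<partial>lborel) \<partial>lborel)"
proof -
  have hm [measurable]: "h \<in> borel_measurable borel" using h by auto
  let ?W = "\<lambda>\<omega>::real \<times> real. exp (- (norm \<omega>)\<^sup>2 / (2 * c\<^sup>2))"
  define C where "C = 2 * pi * c"
  \<comment> \<open>The L^1 norm of \<open>h\<close> bounds its transform uniformly, which provides
    the majorants for the swap and for the integral over \<omega>.\<close>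
  define B where "B = (\<integral>x. norm (h x) \<partial>lborel)"
  have W: "integrable lborel ?W" by (rule integrable_gauss_weight[OF c])
  have qB: "norm (qft h \<omega>) \<le> B" for \<omega> unfolding B_def by (rule norm_qft_le)
  have "(\<integral>\<omega>. ?W \<omega> * (norm (qft h \<omega>))\<^sup>2 \<partial>lborel)
    = (\<integral>\<omega>. \<integral>x. ?W \<omega> * (quat_rot (phase x \<omega>) (h x) \<bullet> qft h \<omega>) \<partial>lborel \<partial>lborel)"
  proof (rule Bochner_Integration.integral_cong)
    fix \<omega>
    have "(\<integral>x. ?W \<omega> * (quat_rot (phase x \<omega>) (h x) \<bullet> qft h \<omega>) \<partial>lborel) = ?W \<omega> * (qft h \<omega> \<bullet> qft h \<omega>)"
      using integral_inner_left[of "qft h \<omega>" lborel "\<lambda>x. quat_rot (phase x \<omega>) (h x)"] integrable_quat_rot[OF h]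
      by (simp add: qft_def[of h \<omega>, symmetric])
    then show "?W \<omega> * (norm (qft h \<omega>))\<^sup>2 = (\<integral>x. ?W \<omega> * (quat_rot (phase x \<omega>) (h x) \<bullet> qft h \<omega>) \<partial>lborel)"
      by (simp add: power2_norm_eq_inner)
  qed simp
  also have "\<dots> = (\<integral>x. \<integral>\<omega>. ?W \<omega> * (quat_rot (phase x \<omega>) (h x) \<bullet> qft h \<omega>) \<partial>lborel \<partial>lborel)"
  proof (rule integral_lborel_swap[OF _ W integrable_mult_right[OF integrable_norm[OF h], of B]])
    fix \<omega> x
    have "\<bar>quat_rot (phase x \<omega>) (h x) \<bullet> qft h \<omega>\<bar> \<le> norm (h x) * norm (qft h \<omega>)"
      using Cauchy_Schwarz_ineq2[of "quat_rot (phase x \<omega>) (h x)" "qft h \<omega>"] by simp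
    also have "\<dots> \<le> norm (h x) * B" by (intro mult_left_mono qB) simp
    finally show "norm (?W \<omega> * (quat_rot (phase x \<omega>) (h x) \<bullet> qft h \<omega>)) \<le> ?W \<omega> * (B * norm (h x))"
      by (simp add: abs_mult mult.commute[of B])
  qed measurable
  also have "\<dots> = (\<integral>x. h x \<bullet> (\<integral>\<omega>. ?W \<omega> *\<^sub>R quat_rot (- phase x \<omega>) (qft h \<omega>) \<partial>lborel) \<partial>lborel)"
  proof (rule Bochner_Integration.integral_cong)
    fix x
    have "integrable lborel (\<lambda>\<omega>. ?W \<omega> *\<^sub>R quat_rot (- phase x \<omega>) (qft h \<omega>))"
      by (rule Bochner_Integration.integrable_bound[OF integrable_mult_left[OF W, of B]])
         (use qB in \<open>auto intro!: order_trans[OF _ abs_ge_self]\<close>)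
    then show "(\<integral>\<omega>. ?W \<omega> * (quat_rot (phase x \<omega>) (h x) \<bullet> qft h \<omega>) \<partial>lborel)
       = h x \<bullet> (\<integral>\<omega>. ?W \<omega> *\<^sub>R quat_rot (- phase x \<omega>) (qft h \<omega>) \<partial>lborel)"
      by (subst integral_inner_right[symmetric]) (simp_all add: inner_quat_rot)
  qed simp
  also have "\<dots> = (\<integral>x. h x \<bullet> (\<integral>s. gauss s *\<^sub>R h (x + s /\<^sub>R C) \<partial>lborel) \<partial>lborel)"
    unfolding integral_gauss_weight_rot_qft[OF h c] C_def ..
  also have "\<dots> = (\<integral>x. \<integral>s. gauss s * (h x \<bullet> h (x + s /\<^sub>R C)) \<partial>lborel \<partial>lborel)"
  proof (rule Bochner_Integration.integral_cong)
    fix x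
    have ih: "integrable lborel (\<lambda>s. h (x + s /\<^sub>R C))"
      using integrable_lborel_scale[of "\<lambda>s. h (s + x)" "1 / C"] integrable_lborel_translate[of h x] h c
      by (simp add: C_def add.commute inverse_eq_divide)
    have "integrable lborel (\<lambda>s. gauss s *\<^sub>R h (x + s /\<^sub>R C))"
      by (rule Bochner_Integration.integrable_bound[OF ih])
         (auto simp: abs_of_pos gauss_pos gauss_bound less_imp_le[OF gauss_pos] intro!: AE_I2 mult_left_le_one_le)
    then show "h x \<bullet> (\<integral>s. gauss s *\<^sub>R h (x + s /\<^sub>R C) \<partial>lborel) = (\<integral>s. gauss s * (h x \<bullet> h (x + s /\<^sub>R C)) \<partial>lborel)"
      by (subst integral_inner_right[symmetric]) simp_all
  qed simp
  \<comment> \<open>The shift couples \<open>s\<close> and \<open>x\<close>, so absolute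
    integrability is checked iteratively: for each \<open>s\<close> the integral over
    \<open>x\<close> is at most \<open>gauss s\<close> times the integral of \<open>|h|^2\<close>.
    Square-integrability of \<open>h\<close> enters here.\<close>
  also have "\<dots> = (\<integral>s. \<integral>x. gauss s * (h x \<bullet> h (x + s /\<^sub>R C)) \<partial>lborel \<partial>lborel)"
  proof (rule lborel_pair.Fubini_integral, rule lborel_pair.Fubini_integrable)
    show "integrable lborel (\<lambda>s. \<integral>x. norm (case (s, x) of (s, x) \<Rightarrow> gauss s * (h x \<bullet> h (x + s /\<^sub>R C))) \<partial>lborel)"
    proof (rule Bochner_Integration.integrable_bound[OF integrable_mult_left[OF integrable_gauss, of "\<integral>x. (norm (h x))\<^sup>2 \<partial>lborel"]])
      show "AE s in lborel. norm (\<integral>x. norm (case (s, x) of (s, x) \<Rightarrow> gauss s * (h x \<bullet> h (x + s /\<^sub>R C))) \<partial>lborel)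
          \<le> norm (gauss s * (\<integral>x. (norm (h x))\<^sup>2 \<partial>lborel))"
        using integral_norm_autocorrelation_le[OF hm h2] gauss_pos
        by (intro AE_I2) (auto simp: abs_mult abs_of_pos intro!: mult_left_mono order_trans[OF _ abs_ge_self] less_imp_le)
    qed measurable
    show "AE s in lborel. integrable lborel (\<lambda>x. case (s, x) of (s, x) \<Rightarrow> gauss s * (h x \<bullet> h (x + s /\<^sub>R C)))"
      using integrable_autocorrelation[OF hm h2] by simp
  qed measurable
  finally show ?thesis by (simp add: C_def)
qed

lemma qft_Plancherel:
  assumes h: "integrable lborel h" and h2: "integrable lborel (\<lambda>x. (norm (h x))\<^sup>2)"
  shows "(\<integral>\<^sup>+\<omega>. ennreal ((norm (qft h \<omega>))\<^sup>2) \<partial>lborel) = (\<integral>\<^sup>+x. ennreal ((norm (h x))\<^sup>2) \<partial>lborel)"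
proof -
  have hm [measurable]: "h \<in> borel_measurable borel" using h by auto
  define N where "N = (\<integral>x. (norm (h x))\<^sup>2 \<partial>lborel)"
  \<comment> \<open>\<open>Suc n\<close> keeps the width of the Gaussian positive from
    \<open>n = 0\<close> on; the weights increase to 1.\<close>
  define W where "W n \<omega> = exp (- (norm \<omega>)\<^sup>2 / (2 * (real (Suc n))\<^sup>2))" for n and \<omega> :: "real \<times> real"
  have [measurable]: "W n \<in> borel_measurable borel" for n unfolding W_def[abs_def] by measurable
  have W_nonneg: "0 \<le> W n \<omega>" for n \<omega> by (simp add: W_def)
  have W_mono: "W m \<omega> \<le> W n \<omega>" if "m \<le> n" for m n \<omega>
    using that by (auto simp: W_def intro!: divide_left_mono power_mono)
  have W_lim: "(\<lambda>n. W n \<omega>) \<longlonglongrightarrow> 1" for \<omega>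
    unfolding W_def by real_asymp
  \<comment> \<open>The shifts tend to 0 for each fixed \<open>s\<close>, and every autocorrelation
    is bounded by \<open>N\<close>, so \<open>gauss s * N\<close> dominates.\<close>
  have "(\<lambda>n. \<integral>s. gauss s * (\<integral>x. h x \<bullet> h (x + s /\<^sub>R (2 * pi * real (Suc n))) \<partial>lborel) \<partial>lborel)
     \<longlonglongrightarrow> (\<integral>s. gauss s * N \<partial>lborel)"
  proof (rule integral_dominated_convergence[where w = "\<lambda>s. gauss s * N"])
    show "AE s in lborel. (\<lambda>n. gauss s * (\<integral>x. h x \<bullet> h (x + s /\<^sub>R (2 * pi * real (Suc n))) \<partial>lborel)) \<longlonglongrightarrow> gauss s * N"
    proof (rule AE_I2)
      fix s :: "real \<times> real"
      have "(\<lambda>n. inverse (2 * pi * real (Suc n))) \<longlonglongrightarrow> 0" by real_asymp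
      then have "(\<lambda>n. s /\<^sub>R (2 * pi * real (Suc n))) \<longlonglongrightarrow> 0"
        using tendsto_scaleR[OF _ tendsto_const[of s]] by fastforce
      from autocorrelation_tendsto[OF hm h2 this]
      show "(\<lambda>n. gauss s * (\<integral>x. h x \<bullet> h (x + s /\<^sub>R (2 * pi * real (Suc n))) \<partial>lborel)) \<longlonglongrightarrow> gauss s * N"
        unfolding N_def by (intro tendsto_mult tendsto_const)
    qed
    show "AE s in lborel. norm (gauss s * (\<integral>x. h x \<bullet> h (x + s /\<^sub>R (2 * pi * real (Suc n))) \<partial>lborel)) \<le> gauss s * N" for n
    proof (rule AE_I2)
      fix s :: "real \<times> real"
      have "norm (\<integral>x. h x \<bullet> h (x + s /\<^sub>R (2 * pi * real (Suc n))) \<partial>lborel) \<le> N"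
        unfolding N_def by (rule order_trans[OF integral_norm_bound integral_norm_autocorrelation_le[OF hm h2]])
      then show "norm (gauss s * (\<integral>x. h x \<bullet> h (x + s /\<^sub>R (2 * pi * real (Suc n))) \<partial>lborel)) \<le> gauss s * N"
        using gauss_pos[of s] by (simp add: abs_mult)
    qed
  qed (auto intro!: integrable_gauss)
  then have J: "(\<lambda>n. \<integral>\<omega>. W n \<omega> * (norm (qft h \<omega>))\<^sup>2 \<partial>lborel) \<longlonglongrightarrow> N"
    unfolding W_def by (subst integral_gauss_weight_qft[OF h h2]) (simp_all add: integral_gauss)
  have int: "integrable lborel (\<lambda>\<omega>. W n \<omega> * (norm (qft h \<omega>))\<^sup>2)" for n
  proof (rule Bochner_Integration.integrable_bound)
    show "integrable lborel (\<lambda>\<omega>. W n \<omega> * (\<integral>x. norm (h x) \<partial>lborel)\<^sup>2)"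
      unfolding W_def using integrable_gauss_weight[of "real (Suc n)"] by simp
    show "AE \<omega> in lborel. norm (W n \<omega> * (norm (qft h \<omega>))\<^sup>2) \<le> norm (W n \<omega> * (\<integral>x. norm (h x) \<partial>lborel)\<^sup>2)"
      using norm_qft_le by (auto simp: abs_mult W_nonneg intro!: mult_left_mono power_mono)
  qed measurable
  \<comment> \<open>Integrability of the squared transform is not yet known; monotone convergence in
    \<open>ennreal\<close> proves it along with the value.\<close>
  have "(\<integral>\<^sup>+\<omega>. ennreal ((norm (qft h \<omega>))\<^sup>2) \<partial>lborel) = (\<integral>\<^sup>+\<omega>. (SUP n. ennreal (W n \<omega> * (norm (qft h \<omega>))\<^sup>2)) \<partial>lborel)"
  proof (rule nn_integral_cong)
    fix \<omega>
    have "(\<lambda>n. ennreal (W n \<omega> * (norm (qft h \<omega>))\<^sup>2)) \<longlonglongrightarrow> ennreal (1 * (norm (qft h \<omega>))\<^sup>2)"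
      by (intro tendsto_ennrealI tendsto_mult W_lim tendsto_const)
    moreover have "(\<lambda>n. ennreal (W n \<omega> * (norm (qft h \<omega>))\<^sup>2)) \<longlonglongrightarrow> (SUP n. ennreal (W n \<omega> * (norm (qft h \<omega>))\<^sup>2))"
      by (rule LIMSEQ_SUP) (auto simp: incseq_def W_mono intro!: ennreal_leI mult_right_mono)
    ultimately show "ennreal ((norm (qft h \<omega>))\<^sup>2) = (SUP n. ennreal (W n \<omega> * (norm (qft h \<omega>))\<^sup>2))"
      using LIMSEQ_unique by fastforce
  qed
  also have "\<dots> = (SUP n. \<integral>\<^sup>+\<omega>. ennreal (W n \<omega> * (norm (qft h \<omega>))\<^sup>2) \<partial>lborel)"
    by (rule nn_integral_monotone_convergence_SUP)
       (auto simp: incseq_def le_fun_def W_mono intro!: ennreal_leI mult_right_mono)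
  also have "\<dots> = (SUP n. ennreal (\<integral>\<omega>. W n \<omega> * (norm (qft h \<omega>))\<^sup>2 \<partial>lborel))"
    by (simp add: nn_integral_eq_integral[OF int] W_nonneg)
  \<comment> \<open>An increasing sequence tends to its supremum, and this one also tends to
    \<open>N\<close>.\<close>
  also have "\<dots> = ennreal N"
  proof (rule LIMSEQ_unique)
    show "(\<lambda>n. ennreal (\<integral>\<omega>. W n \<omega> * (norm (qft h \<omega>))\<^sup>2 \<partial>lborel)) \<longlonglongrightarrow> ennreal N"
      by (intro tendsto_ennrealI J)
    show "(\<lambda>n. ennreal (\<integral>\<omega>. W n \<omega> * (norm (qft h \<omega>))\<^sup>2 \<partial>lborel)) \<longlonglongrightarrow> (SUP n. ennreal (\<integral>\<omega>. W n \<omega> * (norm (qft h \<omega>))\<^sup>2 \<partial>lborel))"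
      by (rule LIMSEQ_SUP) (auto simp: incseq_def W_mono intro!: ennreal_leI integral_mono int mult_right_mono)
  qed
  also have "\<dots> = (\<integral>\<^sup>+x. ennreal ((norm (h x))\<^sup>2) \<partial>lborel)"
    unfolding N_def by (rule nn_integral_eq_integral[OF h2, symmetric]) simp
  finally show ?thesis .
qed

subsection \<open>The Gabor transform\<close>

text \<open>The real-valued case is applied to each coordinate; the basis is finite, so the
  exceptional null sets can be united.\<close>

lemma completion_ex_borel_measurable_euclidean:
  fixes f :: "'a \<Rightarrow> 'b::euclidean_space"
  assumes f: "f \<in> borel_measurable (completion M)"
  shows "\<exists>g\<in>borel_measurable M. AE x in M. f x = g x"
proof -
  have "\<forall>b. \<exists>g\<in>borel_measurable M. AE x in M. f x \<bullet> b = g x"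
    by (intro allI completion_ex_borel_measurable_real borel_measurable_inner f borel_measurable_const)
  then obtain g where [measurable]: "\<And>b. g b \<in> borel_measurable M"
    and g: "\<And>b. AE x in M. f x \<bullet> b = g b x" by metis
  have "AE x in M. \<forall>b\<in>Basis. f x \<bullet> b = g b x"
    using g by (intro AE_finite_allI) auto
  then have "AE x in M. f x = (\<Sum>b\<in>Basis. g b x *\<^sub>R b)"
  proof eventually_elim
    case (elim x)
    then have "(\<Sum>b\<in>Basis. g b x *\<^sub>R b) = (\<Sum>b\<in>Basis. (f x \<bullet> b) *\<^sub>R b)"
      by (intro sum.cong) auto
    then show ?case by (simp add: euclidean_representation)
  qed
  then show ?thesis by (intro bexI[of _ "\<lambda>x. \<Sum>b\<in>Basis. g b x *\<^sub>R b"]) auto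
qed

lemma nn_integral_lborel_reflect:
  fixes g :: "'a::euclidean_space \<Rightarrow> ennreal"
  assumes [measurable]: "g \<in> borel_measurable borel"
  shows "(\<integral>\<^sup>+x. g (t - x) \<partial>lborel) = (\<integral>\<^sup>+x. g x \<partial>lborel)"
proof -
  have "distr lborel borel (\<lambda>x. t - x) = lborel"
    using lborel_affine[of "-1" t, symmetric] by (simp add: density_1)
  then have "(\<integral>\<^sup>+x. g x \<partial>lborel) = (\<integral>\<^sup>+x. g x \<partial>distr lborel borel (\<lambda>x. t - x))"
    by simp
  also have "\<dots> = (\<integral>\<^sup>+x. g (t - x) \<partial>lborel)"
    by (subst nn_integral_distr) simp_all
  finally show ?thesis ..
qed

lemma AE_lborel_translate:
  fixes t :: "'a::euclidean_space"
  assumes "AE x in lborel. P x"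
  shows "AE x in lborel. P (x + t)"
proof -
  obtain N where N: "{x. \<not> P x} \<subseteq> N" "emeasure lborel N = 0" "N \<in> sets lborel"
    using AE_E[OF assms] by auto
  then have "N \<in> sets borel" by simp
  note [measurable] = this
  have "emeasure lborel {x. x + t \<in> N} = (\<integral>\<^sup>+x. indicator N (x + t) \<partial>lborel)"
    by (subst nn_integral_indicator[symmetric]) (auto simp del: nn_integral_indicator simp: indicator_def intro!: nn_integral_cong)
  also have "\<dots> = 0" using N by (simp add: nn_integral_lborel_translate)
  finally have "emeasure lborel {x. x + t \<in> N} = 0" .
  then show ?thesis using N(1) by (intro AE_I[where N = "{x. x + t \<in> N}"]) auto
qed

lemma measurable_lebesgue_translate:
  fixes t :: "'a::euclidean_space"
  shows "(\<lambda>x. x + t) \<in> lebesgue \<rightarrow>\<^sub>M lebesgue"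
  using lebesgue_affine_measurable[of "\<lambda>_. 1" t] by (simp add: euclidean_representation add.commute)

lemma norm_quat_cnj [simp]: "norm (quat_cnj q) = norm q"
  by (simp add: quat_norm_eq)

lemma measurable_quat_cnj [measurable (raw)]:
  assumes [measurable]: "f \<in> borel_measurable M"
  shows "(\<lambda>x. quat_cnj (f x)) \<in> borel_measurable M"
proof -
  have "linear quat_cnj" by (intro linearI) (simp_all add: quat_eq_iff)
  then have "quat_cnj \<in> borel_measurable borel"
    by (intro borel_measurable_continuous_onI linear_continuous_on linear_conv_bounded_linear[THEN iffD1])
  then show ?thesis by (rule measurable_compose[OF assms])
qed

text \<open>For each fixed \<open>b\<close> the translated exceptional set is still null, so
  replacing both functions by Borel representatives leaves the integral unchanged. The equality thus
  holds at every \<omega> and \<open>b\<close>, not merely almost everywhere.\<close>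

lemma gqft_eq_qft:
  assumes f: "f \<in> borel_measurable lebesgue" and \<phi>: "\<phi> \<in> borel_measurable lebesgue"
    and [measurable]: "f' \<in> borel_measurable borel" "\<phi>' \<in> borel_measurable borel"
    and eq: "AE x in lborel. f x = f' x" "AE x in lborel. \<phi> x = \<phi>' x"
  shows "gqft \<phi> f \<omega> b = qft (\<lambda>x. f' x * quat_cnj (\<phi>' (x - b))) \<omega>"
proof -
  note [measurable] = f
  have [measurable]: "(\<lambda>x. \<phi> (x - b)) \<in> borel_measurable lebesgue"
    using measurable_compose[OF measurable_lebesgue_translate[of "- b"] \<phi>] by simp
  have [measurable]: "(\<lambda>x. phase x \<omega>) \<in> borel_measurable lebesgue"
    by (intro measurable_completion) measurable
  have "gqft \<phi> f \<omega> b = (\<integral>x. quat_rot (phase x \<omega>) (f x * quat_cnj (\<phi> (x - b))) \<partial>lebesgue)"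
    unfolding gqft_def quat_rot_def phase_def by (simp add: mult.assoc)
  also have "\<dots> = (\<integral>x. quat_rot (phase x \<omega>) (f' x * quat_cnj (\<phi>' (x - b))) \<partial>lebesgue)"
  proof (rule integral_cong_AE)
    show "(\<lambda>x. quat_rot (phase x \<omega>) (f' x * quat_cnj (\<phi>' (x - b)))) \<in> borel_measurable lebesgue"
      by (intro measurable_completion) measurable
    have "AE x in lborel. f x = f' x \<and> \<phi> (x - b) = \<phi>' (x - b)"
      using eq(1) AE_lborel_translate[OF eq(2), of "- b"] by simp
    then have "AE x in lebesgue. f x = f' x \<and> \<phi> (x - b) = \<phi>' (x - b)"
      by (rule AE_completion)
    then show "AE x in lebesgue. quat_rot (phase x \<omega>) (f x * quat_cnj (\<phi> (x - b)))
        = quat_rot (phase x \<omega>) (f' x * quat_cnj (\<phi>' (x - b)))"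
      by eventually_elim simp
  qed measurable
  also have "\<dots> = qft (\<lambda>x. f' x * quat_cnj (\<phi>' (x - b))) \<omega>"
    unfolding qft_def by (rule integral_completion) measurable
  finally show ?thesis .
qed

theorem theorem3p4:
  fixes \<phi> f :: "real \<times> real \<Rightarrow> quat"
  assumes "\<phi> \<in> quat_L2" and "\<phi> \<noteq> (\<lambda>x. 0)" and "f \<in> quat_L2"
  shows "gqft_norm_sq \<phi> f = quat_L2_norm_sq f * quat_L2_norm_sq \<phi>"
proof -
  have f: "f \<in> borel_measurable lebesgue" and \<phi>: "\<phi> \<in> borel_measurable lebesgue"
    using assms by (auto simp: quat_L2_def)
  \<comment> \<open>Borel representatives make the two-variable integrand
    \<open>F x * G (x - b)\<close> measurable for the product of Borel measures, as Tonelli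
    requires.\<close>
  obtain f' where [measurable]: "f' \<in> borel_measurable borel" and f': "AE x in lborel. f x = f' x"
    using completion_ex_borel_measurable_euclidean[OF f] by auto
  obtain \<phi>' where [measurable]: "\<phi>' \<in> borel_measurable borel" and \<phi>': "AE x in lborel. \<phi> x = \<phi>' x"
    using completion_ex_borel_measurable_euclidean[OF \<phi>] by auto
  define F where "F x = ennreal ((norm (f' x))\<^sup>2)" for x
  define G where "G x = ennreal ((norm (\<phi>' x))\<^sup>2)" for x
  have [measurable]: "F \<in> borel_measurable borel" "G \<in> borel_measurable borel"
    unfolding F_def[abs_def] G_def[abs_def] by measurable
  have F: "quat_L2_norm_sq f = (\<integral>\<^sup>+x. F x \<partial>lborel)"
    unfolding quat_L2_norm_sq_def nn_integral_completion F_def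
    using f' by (intro nn_integral_cong_AE) auto
  have G: "quat_L2_norm_sq \<phi> = (\<integral>\<^sup>+x. G x \<partial>lborel)"
    unfolding quat_L2_norm_sq_def nn_integral_completion G_def
    using \<phi>' by (intro nn_integral_cong_AE) auto
  have fin: "(\<integral>\<^sup>+x. F x \<partial>lborel) < \<infinity>" "(\<integral>\<^sup>+x. G x \<partial>lborel) < \<infinity>"
    using assms by (auto simp: quat_L2_def F G)
  have Gt: "(\<integral>\<^sup>+x. G (x - b) \<partial>lborel) = (\<integral>\<^sup>+x. G x \<partial>lborel)" for b
    using nn_integral_lborel_translate[of G "- b"] by simp
  define h where "h b x = f' x * quat_cnj (\<phi>' (x - b))" for b x
  have [measurable]: "h b \<in> borel_measurable borel" for b
    unfolding h_def[abs_def] by measurable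
  have h_sq: "ennreal ((norm (h b x))\<^sup>2) = F x * G (x - b)" for b x
    by (simp add: h_def F_def G_def norm_mult power_mult_distrib ennreal_mult')
  \<comment> \<open>The product of two moduli is at most the sum of their squares, so
    \<open>h b\<close> is integrable for every \<open>b\<close>.\<close>
  have h1: "integrable lborel (h b)" for b
  proof (rule Bochner_Integration.integrable_bound)
    have "integrable lborel (\<lambda>x. (norm (f' x))\<^sup>2)"
      using fin(1) by (intro integrableI_nonneg) (auto simp: F_def)
    moreover have "integrable lborel (\<lambda>x. (norm (\<phi>' (x - b)))\<^sup>2)"
      using fin(2) Gt[of b] by (intro integrableI_nonneg) (auto simp: G_def)
    ultimately show "integrable lborel (\<lambda>x. (norm (f' x))\<^sup>2 + (norm (\<phi>' (x - b)))\<^sup>2)"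
      by simp
    show "AE x in lborel. norm (h b x) \<le> norm ((norm (f' x))\<^sup>2 + (norm (\<phi>' (x - b)))\<^sup>2)"
    proof (rule AE_I2)
      fix x
      have "0 \<le> norm (f' x) * norm (\<phi>' (x - b))" by simp
      from add_mono[OF this this] show "norm (h b x) \<le> norm ((norm (f' x))\<^sup>2 + (norm (\<phi>' (x - b)))\<^sup>2)"
        using sum_squares_bound[of "norm (f' x)" "norm (\<phi>' (x - b))"]
        unfolding h_def norm_mult norm_quat_cnj real_norm_def by linarith
    qed
  qed measurable
  have total: "(\<integral>\<^sup>+b. \<integral>\<^sup>+x. F x * G (x - b) \<partial>lborel \<partial>lborel) = (\<integral>\<^sup>+x. F x \<partial>lborel) * (\<integral>\<^sup>+x. G x \<partial>lborel)"
  proof -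
    have "(\<integral>\<^sup>+b. \<integral>\<^sup>+x. F x * G (x - b) \<partial>lborel \<partial>lborel) = (\<integral>\<^sup>+x. \<integral>\<^sup>+b. F x * G (x - b) \<partial>lborel \<partial>lborel)"
      by (rule lborel_pair.Fubini') measurable
    \<comment> \<open>For fixed \<open>x\<close> the reflection sending \<open>b\<close> to
      \<open>x - b\<close> preserves Lebesgue measure, so the inner integral is independent of
      \<open>x\<close>.\<close>
    also have "\<dots> = (\<integral>\<^sup>+x. F x * (\<integral>\<^sup>+y. G y \<partial>lborel) \<partial>lborel)"
      by (simp add: nn_integral_cmult nn_integral_lborel_reflect)
    also have "\<dots> = (\<integral>\<^sup>+x. F x \<partial>lborel) * (\<integral>\<^sup>+x. G x \<partial>lborel)"
      by (rule nn_integral_multc) measurable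
    finally show ?thesis .
  qed
  \<comment> \<open>The total integral is finite, hence the inner one is finite for almost every
    \<open>b\<close>. These are the \<open>b\<close> for which \<open>h b\<close> is
    square-integrable and Plancherel applies.\<close>
  have "AE b in lborel. (\<integral>\<^sup>+x. F x * G (x - b) \<partial>lborel) \<noteq> \<infinity>"
    using fin by (intro nn_integral_PInf_AE) (auto simp: total ennreal_mult_eq_top_iff)
  then have "AE b in lborel. (\<integral>\<^sup>+\<omega>. ennreal ((norm (gqft \<phi> f \<omega> b))\<^sup>2) \<partial>lborel) = (\<integral>\<^sup>+x. F x * G (x - b) \<partial>lborel)"
  proof eventually_elim
    case (elim b)
    have "integrable lborel (\<lambda>x. (norm (h b x))\<^sup>2)"
      using elim by (intro integrableI_nonneg) (auto simp: h_sq less_top)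
    from qft_Plancherel[OF h1 this] show ?case
      unfolding h_sq [symmetric] gqft_eq_qft[OF f \<phi> \<open>f' \<in> _\<close> \<open>\<phi>' \<in> _\<close> f' \<phi>'] h_def .
  qed
  then have "gqft_norm_sq \<phi> f = (\<integral>\<^sup>+b. \<integral>\<^sup>+x. F x * G (x - b) \<partial>lborel \<partial>lborel)"
    unfolding gqft_norm_sq_def nn_integral_completion by (rule nn_integral_cong_AE)
  then show ?thesis by (simp add: total F G)
qed

end
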